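(* Let $\mathbb{P}_\infty$ be the set of all odd integral multiples of $p$ and let $\mathbb{P}_0$ be the set of all even integral multiples of $p$. Let $f : \mathbb{C} \setminus \mathbb{P}_\infty \to \mathbb{C}$ be the unique holomorphic function satisfying $f(0) = 0$ and $f'(z) = 1 + f(z)^2$ for all $z \in \mathbb{C} \setminus \mathbb{P}_\infty$. Then the set of periods of $f$ is precisely $\mathbb{P}_0$.
   Context: A period of $f : \mathbb{C} \setminus \mathbb{P}_\infty \to \mathbb{C}$ is a complex number $a$ (with $a = 0$ allowed) such that for every $z \in \mathbb{C} \setminus \mathbb{P}_\infty$ one has $a + z \in \mathbb{C} \setminus \mathbb{P}_\infty$ and $f(a + z) = f(z)$. Write $B_r(0)$ for the open disc of radius $r$ about $0$ in $\mathbb{C}$. There is a unique holomorphic function $h : B_{1/2}(0) \to \mathbb{C}$ with $h(0)=0$ and $h' = 1 + h^2$; it takes values in the open unit disc. It extends to a holomorphic function $h : B_1(0) \to \mathbb{C}$, given by $z \mapsto \frac{2h(z/2)}{1 - h(z/2)^2}$ in terms of the original $h$ on $B_{1/2}(0)$, which again satisfies $h(0)=0$ and $h'=1+h^2$. It is real-valued on $(-1,1)$. The real number $p$ is the unique $p \in (0,2)$ such that $h(\tfrac12 p) = 1$; equivalently $\tfrac12 p = \int_0^1 \frac{dt}{1+t^2}$. The existence and uniqueness of the holomorphic function $f$ on $\mathbb{C} \setminus \mathbb{P}_\infty$ described in the claim is established in the paper and may be taken as given; $f$ extends $h$. *)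

theory Defs
  imports "HOL-Complex_Analysis.Complex_Analysis"
begin

(* Uniqueness holds only for functions with domain the disc, so the values of the total function
   off the disc are pinned down by extensionality. *)
definition h_half :: "complex \<Rightarrow> complex" where
  "h_half = (THE h. h \<in> extensional (ball 0 (1/2)) \<and> h holomorphic_on ball 0 (1/2) \<and> h 0 = 0 \<and>
     (\<forall>z\<in>ball 0 (1/2). deriv h z = 1 + (h z)\<^sup>2))"

definition h_unit :: "complex \<Rightarrow> complex" where
  "h_unit = (\<lambda>z\<in>ball 0 1. 2 * h_half (z/2) / (1 - (h_half (z/2))\<^sup>2))"

definition p_const :: real where
  "p_const = (THE p. 0 < p \<and> p < 2 \<and> h_unit (of_real (p/2)) = 1)"

definition P_infinity :: "complex set" where
  "P_infinity = {of_int k * of_real p_const |k. odd (k::int)}"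

definition P_zero :: "complex set" where
  "P_zero = {of_int k * of_real p_const |k. even (k::int)}"

definition is_period :: "(complex \<Rightarrow> complex) \<Rightarrow> complex \<Rightarrow> bool" where
  "is_period f a \<longleftrightarrow> (\<forall>z\<in>UNIV - P_infinity. a + z \<in> UNIV - P_infinity \<and> f (a + z) = f z)"

end

theory Submission imports Defs begin

text \<open>
  If f' = 1 + f^2, then w = f cos - sin satisfies the linear equation w' = f w, so f(0) = 0 forces
  w = 0 near 0, and everywhere on a connected domain by analytic continuation: f is the tangent.
  Hence p = pi/2, the removed points are exactly the zeros of the cosine, and the claim is that the
  periods of the tangent are the zeros of the sine.
\<close>

text \<open>Sine and cosine have no common zero, because their squares sum to 1. This is what keeps
  the zeros of the cosine out of the domain of any solution.\<close>

lemma cos_nonzero_if_sin_eq: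
  fixes z :: complex
  assumes "w * cos z = sin z"
  shows "cos z \<noteq> 0"
proof
  assume "cos z = 0"
  with assms have "sin z = 0"
    by simp
  with \<open>cos z = 0\<close> show False
    using sin_cos_squared_add[of z] by simp
qed

text \<open>Convexity supplies a primitive \<open>F\<close> of \<open>f\<close>, so the linear
  equation w' = f w for w = f cos - sin can be solved with an integrating factor.\<close>

lemma riccati_solution_local:
  fixes f :: "complex \<Rightarrow> complex"
  assumes "convex S" "open S" "0 \<in> S" and hol: "f holomorphic_on S"
    and "f 0 = 0" and ode: "\<And>z. z \<in> S \<Longrightarrow> deriv f z = 1 + (f z)\<^sup>2"
    and "z \<in> S"
  shows "f z * cos z = sin z"
proof -
  obtain F where "\<And>x. x \<in> S \<Longrightarrow> (F has_field_derivative f x) (at x within S)"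
    using holomorphic_convex_primitive'[OF \<open>convex S\<close> \<open>open S\<close> hol] by blast
  then have F: "(F has_field_derivative f x) (at x)" if "x \<in> S" for x
    using that \<open>open S\<close> at_within_open by metis
  have f: "(f has_field_derivative 1 + (f x)\<^sup>2) (at x)" if "x \<in> S" for x
    using holomorphic_derivI[OF hol \<open>open S\<close> that] ode[OF that] by simp
  \<comment> \<open>\<open>exp (- F x)\<close> is the integrating factor: g' = (w' - f w) exp(-F) =
    0.\<close>
  define g where "g x = (f x * cos x - sin x) * exp (- F x)" for x
  have "(g has_field_derivative 0) (at x within S)" if "x \<in> S" for x
    unfolding g_def
    by (rule DERIV_subset[OF _ subset_UNIV])
      (auto intro!: derivative_eq_intros F f that simp: algebra_simps power2_eq_square)
  then obtain c where "\<And>x. x \<in> S \<Longrightarrow> g x = c"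
    using has_field_derivative_zero_constant[OF \<open>convex S\<close>] by blast
  moreover have "g 0 = 0"
    by (simp add: g_def \<open>f 0 = 0\<close>)
  ultimately have "g z = 0"
    using \<open>0 \<in> S\<close> \<open>z \<in> S\<close> by auto
  then show ?thesis
    by (simp add: g_def)
qed

text \<open>On a domain that is merely connected \<open>f\<close> may have no primitive: the tangent
  has nonzero residues at its poles. So the local result is applied on a disc around 0, and the
  identity theorem carries it to \<open>S\<close>.\<close>

lemma riccati_solution:
  fixes f :: "complex \<Rightarrow> complex"
  assumes "open S" "connected S" "0 \<in> S" and hol: "f holomorphic_on S"
    and "f 0 = 0" and ode: "\<And>z. z \<in> S \<Longrightarrow> deriv f z = 1 + (f z)\<^sup>2"
    and "z \<in> S"
  shows "cos z \<noteq> 0" and "f z = tan z"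
proof -
  obtain r where r: "r > 0" "ball 0 r \<subseteq> S"
    using \<open>open S\<close> \<open>0 \<in> S\<close> open_contains_ball by blast
  have "f holomorphic_on ball 0 r"
    using hol r(2) by (rule holomorphic_on_subset)
  then have "f w * cos w = sin w" if "w \<in> ball 0 r" for w
    using riccati_solution_local[of "ball 0 r" f w] r that ode \<open>f 0 = 0\<close>
    by (simp add: subset_iff)
  then have zero: "f w * cos w - sin w = 0" if "w \<in> ball 0 r" for w
    using that by simp
  have "(\<lambda>z. f z * cos z - sin z) holomorphic_on S"
    by (intro holomorphic_intros hol)
  moreover have "0 islimpt ball (0::complex) r"
    using r(1) by (simp add: islimpt_ball)
  ultimately have "f z * cos z - sin z = 0"
    by (rule analytic_continuation[OF _ \<open>open S\<close> \<open>connected S\<close> r(2) \<open>0 \<in> S\<close>])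
      (use zero \<open>z \<in> S\<close> in auto)
  then have *: "f z * cos z = sin z"
    by simp
  from * show "cos z \<noteq> 0"
    by (rule cos_nonzero_if_sin_eq)
  with * show "f z = tan z"
    by (simp add: tan_def field_simps)
qed

text \<open>All complex zeros of the cosine are real, namely the odd multiples of pi/2. Since pi >
  3, the discs of radius 1/2 and 1 about 0 avoid them.\<close>

lemma cos_complex_nonzero:
  fixes z :: complex
  assumes "norm z < pi / 2"
  shows "cos z \<noteq> 0"
proof
  assume "cos z = 0"
  then obtain n :: int where "z = of_real (n * pi + pi / 2)"
    by (auto simp: cos_eq_0)
  then have "norm z = \<bar>n * pi + pi / 2\<bar>"
    by (simp only: norm_of_real)
  also have "\<dots> = \<bar>real_of_int (2 * n + 1) * (pi / 2)\<bar>"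
    by (simp add: algebra_simps)
  also have "\<dots> = real_of_int \<bar>2 * n + 1\<bar> * (pi / 2)"
    by (simp add: abs_mult)
  also have "\<dots> \<ge> 1 * (pi / 2)"
  proof (rule mult_right_mono)
    have "1 \<le> \<bar>2 * n + 1\<bar>"
      by presburger
    then show "1 \<le> real_of_int \<bar>2 * n + 1\<bar>"
      by linarith
  qed simp
  finally show False
    using assms by simp
qed

lemma h_half_eq: "h_half = (\<lambda>z\<in>ball 0 (1/2). tan z)"
proof -
  let ?B = "ball (0::complex) (1/2)"
  have cos: "cos z \<noteq> 0" if "z \<in> ?B" for z
    using that pi_gt3 by (intro cos_complex_nonzero) auto
  have tan: "deriv (restrict tan ?B) z = 1 + (restrict tan ?B z)\<^sup>2" if "z \<in> ?B" for z
  proof -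
    \<comment> \<open>A derivative depends only on values near \<open>z\<close>, and the restriction
      agrees with the tangent on the open disc.\<close>
    have "deriv (restrict tan ?B) z = deriv tan z"
      by (rule deriv_cong_ev) (use that eventually_nhds_in_open[of ?B z] in \<open>auto elim: eventually_mono\<close>)
    also have "\<dots> = 1 + (tan z)\<^sup>2"
      using DERIV_imp_deriv[OF DERIV_tan[OF cos[OF that]]] cos[OF that]
      by (simp add: tan_sec power_inverse)
    finally show ?thesis
      using that by simp
  qed
  have hol: "restrict tan ?B holomorphic_on ?B"
    by (rule holomorphic_transform[OF holomorphic_on_tan]) (use cos in auto)
  show ?thesis
    unfolding h_half_def
  proof (rule the_equality)
    show "restrict tan ?B \<in> extensional ?B \<and> restrict tan ?B holomorphic_on ?B \<and>
      restrict tan ?B 0 = 0 \<and> (\<forall>z\<in>?B. deriv (restrict tan ?B) z = 1 + (restrict tan ?B z)\<^sup>2)"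
      using tan hol by simp
  next
    fix h
    assume h: "h \<in> extensional ?B \<and> h holomorphic_on ?B \<and> h 0 = 0 \<and>
      (\<forall>z\<in>?B. deriv h z = 1 + (h z)\<^sup>2)"
    show "h = restrict tan ?B"
    proof (rule extensionalityI)
      show "h z = restrict tan ?B z" if "z \<in> ?B" for z
        using riccati_solution(2)[of ?B h z] h that by simp
    qed (use h in auto)
  qed
qed

text \<open>The formula defining the extension is the double-angle formula for the tangent.\<close>

lemma h_unit_eq:
  assumes "norm z < 1"
  shows "h_unit z = tan z"
proof -
  have "cos z \<noteq> 0" "cos (z / 2) \<noteq> 0"
    using assms pi_gt3 by (auto intro!: cos_complex_nonzero simp: norm_divide)
  then have "tan z = 2 * tan (z / 2) / (1 - (tan (z / 2))\<^sup>2)"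
    using tan_double[of "z / 2"] by simp
  then show ?thesis
    using assms by (simp add: h_unit_def h_half_eq norm_divide)
qed

lemma p_const_eq: "p_const = pi / 2"
  unfolding p_const_def
proof (rule the_equality)
  \<comment> \<open>The bound pi < 4 puts pi/4 inside the unit disc.\<close>
  have "h_unit (of_real (pi / 2 / 2)) = of_real (tan (pi / 4))"
    using pi_less_4 by (subst h_unit_eq) (auto simp: tan_of_real)
  then show "0 < pi / 2 \<and> pi / 2 < 2 \<and> h_unit (of_real (pi / 2 / 2)) = 1"
    using pi_less_4 by (simp add: tan_45)
next
  fix q :: real
  assume q: "0 < q \<and> q < 2 \<and> h_unit (of_real (q / 2)) = 1"
  then have "h_unit (of_real (q / 2)) = of_real (tan (q / 2))"
    by (subst h_unit_eq) (auto simp: tan_of_real)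
  with q have "tan (q / 2) = 1"
    by (metis of_real_eq_1_iff)
  \<comment> \<open>Uniqueness: q/2 < 1 < pi/2, so q/2 lies on the branch where
    \<open>arctan\<close> inverts the tangent.\<close>
  then have "arctan 1 = q / 2"
    using q pi_gt3 by (intro arctan_unique) auto
  then show "q = pi / 2"
    by simp
qed

lemma P_zero_eq: "P_zero = {z. sin z = 0}"
proof -
  have "P_zero = range (\<lambda>n::int. of_int (2 * n) * of_real p_const)"
    by (fastforce simp: P_zero_def simp del: of_int_mult elim!: evenE)
  also have "\<dots> = range (\<lambda>n::int. of_real (n * pi))"
    by (simp add: p_const_eq)
  finally show ?thesis
    by (auto simp: sin_eq_0)
qed

lemma P_infinity_eq: "P_infinity = {z. cos z = 0}"
proof -
  have "P_infinity = range (\<lambda>n::int. of_int (2 * n + 1) * of_real p_const)"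
    unfolding P_infinity_def by (fastforce elim!: oddE)
  also have "\<dots> = range (\<lambda>n::int. of_real (n * pi) + of_real pi / 2)"
    by (simp add: p_const_eq distrib_right add_divide_distrib)
  finally show ?thesis
    by (auto simp: cos_eq_0)
qed

theorem theorem10:
  fixes f :: "complex \<Rightarrow> complex"
  assumes "f holomorphic_on (UNIV - P_infinity)"
    and "f 0 = 0"
    and "\<forall>z\<in>UNIV - P_infinity. deriv f z = 1 + (f z)\<^sup>2"
  shows "{a. is_period f a} = P_zero"
proof -
  have "closed P_infinity"
    unfolding P_infinity_eq by (intro closed_Collect_eq continuous_intros)
  then have "open (UNIV - P_infinity)"
    by (simp add: open_Diff)
  moreover have "countable P_infinity"
    by (rule countable_subset[of _ "range (\<lambda>k::int. of_int k * of_real p_const)"])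
      (auto simp: P_infinity_def)
  \<comment> \<open>Removing a countable closed set does not disconnect the plane, so the identity
    theorem applies.\<close>
  then have "connected (UNIV - P_infinity)"
    by (intro connected_open_diff_countable) auto
  moreover have "0 \<in> UNIV - P_infinity"
    by (simp add: P_infinity_eq)
  ultimately have f: "f z = tan z" if "cos z \<noteq> 0" for z
    using riccati_solution(2)[OF _ _ _ assms(1,2)] assms(3) that by (auto simp: P_infinity_eq)
  have "is_period f a \<longleftrightarrow> sin a = 0" for a
  proof
    assume "is_period f a"
    \<comment> \<open>Testing the period at 0 suffices. The domain condition rules out cos a = 0,
      where the quotient defining \<open>tan\<close> would be 0 by convention.\<close>
    then have "cos (a + 0) \<noteq> 0 \<and> f (a + 0) = f 0"
      unfolding is_period_def P_infinity_eq by (auto dest: bspec[of _ _ 0])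
    then show "sin a = 0"
      using f[of a] \<open>f 0 = 0\<close> by (simp add: tan_def)
  next
    assume "sin a = 0"
    moreover from this have "cos a \<noteq> 0"
      using sin_cos_squared_add[of a] by auto
    \<comment> \<open>As sin a = 0, the addition formulas reduce to cos(a + z) = cos a cos z and
      sin(a + z) = cos a sin z. The nonzero factor cos a preserves the domain and cancels in the
      quotient.\<close>
    ultimately show "is_period f a"
      by (auto simp: is_period_def P_infinity_eq f cos_add sin_add tan_def)
  qed
  then show ?thesis
    by (simp add: P_zero_eq)
qed

end
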